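(* Let $\alpha^*=\mathbb{E}_C[\mathrm{wkt}_C(\vec e_{\mathsf o})]/\mathbb{E}_C[\mathrm{wkt}_C(\vec e_{\mathsf a})]$, where the expectation is over an input array $C$ of $N$ integers each drawn uniformly from $\{0,\dots,2^n-1\}$. Then $\alpha^*=\Omega\!\left(\frac{2^{n/2}}{N\log N}\right)$.
   Context: An input is an array $C[1..N]$ of $n$-bit integers, bits indexed $1$ (least significant) to $n$ (most significant); entries are assumed distinct. An energy vector $\vec e=(e_1,\dots,e_n)$ assigns energy $e_j\ge0$ to bit $j$. An inexact comparison of two items $u,v$ with energy vector $\vec e$ reads each bit $j$ of $u$ and of $v$ independently, flipped with probability $2^{-e_j}$, and orders $u,v$ according to the read values (i.e., by the most significant bit at which the read values differ); each comparison uses fresh independent randomness. The array is sorted by randomized quicksort (pivot chosen uniformly at random from the current subarray, each other element placed on a side by an inexact comparison with the pivot, then recursion). For items $u,v$, $Q(u,v,\vec e)$ is the event that in the output of quicksort $u$ and $v$ are in the wrong relative order. The expected weighted Kendall $\tau$ distance is $\mathrm{wkt}_C(\vec e)=\sum_{1\le a<b\le N}|C[a]-C[b]|\cdot\Pr[Q(C[a],C[b],\vec e)]$, the probability being over pivot choices and comparison errors. The inexactness aware vector is $\vec e_{\mathsf a}=(1,2,\dots,n)$ (bit $j$ gets energy $j$) and the oblivious vector is $\vec e_{\mathsf o}=(\frac{n+1}{2},\dots,\frac{n+1}{2})$. *)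

theory Defs
  imports "HOL-Probability.Probability"
begin

text \<open>Noisy reading of the lowest k bits of u (bits indexed 1..k, bit j has value 2^(j-1)).
  Bit j is read flipped with probability 2 powr (- e j), independently.\<close>
fun noisy_read :: "(nat \<Rightarrow> real) \<Rightarrow> nat \<Rightarrow> nat \<Rightarrow> nat pmf" where
  "noisy_read e 0 u = return_pmf 0"
| "noisy_read e (Suc k) u =
     bind_pmf (noisy_read e k u) (\<lambda>r.
     bind_pmf (bernoulli_pmf (2 powr (- e (Suc k)))) (\<lambda>flip.
     return_pmf (r + (if (if flip then \<not> bit u k else bit u k) then 2 ^ k else 0))))"

definition inexact_less :: "(nat \<Rightarrow> real) \<Rightarrow> nat \<Rightarrow> nat list \<Rightarrow> nat \<Rightarrow> nat \<Rightarrow> bool pmf" where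
  "inexact_less e n C x p =
     bind_pmf (noisy_read e n (C ! x)) (\<lambda>rx.
     bind_pmf (noisy_read e n (C ! p)) (\<lambda>rp. return_pmf (rx < rp)))"

fun partition_pmf :: "('a \<Rightarrow> 'a \<Rightarrow> bool pmf) \<Rightarrow> 'a \<Rightarrow> 'a list \<Rightarrow> ('a list \<times> 'a list) pmf" where
  "partition_pmf lt p [] = return_pmf ([], [])"
| "partition_pmf lt p (x # xs) =
     bind_pmf (lt x p) (\<lambda>b.
     bind_pmf (partition_pmf lt p xs) (\<lambda>lr.
     return_pmf (if b then (x # fst lr, snd lr) else (fst lr, x # snd lr))))"

lemma partition_pmf_length:
  "lr \<in> set_pmf (partition_pmf lt p xs) \<Longrightarrow> length (fst lr) + length (snd lr) = length xs"
  by (induction xs arbitrary: lr) (auto split: if_splits)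

function quicksort_pmf :: "('a \<Rightarrow> 'a \<Rightarrow> bool pmf) \<Rightarrow> 'a list \<Rightarrow> 'a list pmf" where
  "quicksort_pmf lt xs =
     (if xs = [] then return_pmf []
      else bind_pmf (pmf_of_set {0..<length xs}) (\<lambda>i.
           bind_pmf (partition_pmf lt (xs ! i) (take i xs @ drop (Suc i) xs)) (\<lambda>lr.
           bind_pmf (quicksort_pmf lt (fst lr)) (\<lambda>sl.
           bind_pmf (quicksort_pmf lt (snd lr)) (\<lambda>sr.
           return_pmf (sl @ xs ! i # sr))))))"
  by pat_completeness auto
termination
proof (relation "Wellfounded.measure (\<lambda>(lt, xs). length xs)", goal_cases)
  case 1 then show ?case by simp
next
  case (2 lt xs i lr)
  then have "i < length xs" by (auto simp: set_pmf_of_set)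
  with partition_pmf_length[OF 2(3)] show ?case by auto
next
  case (3 lt xs i lr sl)
  then have "i < length xs" by (auto simp: set_pmf_of_set)
  with partition_pmf_length[OF 3(3)] show ?case by auto
qed

definition misordered :: "nat list \<Rightarrow> nat \<Rightarrow> nat \<Rightarrow> nat list \<Rightarrow> bool" where
  "misordered C a b out =
     (\<exists>i<length out. \<exists>j<length out. i < j \<and>
        ((out ! i = a \<and> out ! j = b \<and> C ! b < C ! a) \<or>
         (out ! i = b \<and> out ! j = a \<and> C ! a < C ! b)))"

definition wkt :: "nat \<Rightarrow> nat list \<Rightarrow> (nat \<Rightarrow> real) \<Rightarrow> real" where
  "wkt n C e =
     (\<Sum>a<length C. \<Sum>b\<in>{a<..<length C}.
        \<bar>real (C ! a) - real (C ! b)\<bar> *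
        measure_pmf.prob (quicksort_pmf (inexact_less e n C) [0..<length C])
           {out. misordered C a b out})"

definition e_aware :: "nat \<Rightarrow> nat \<Rightarrow> real" where
  "e_aware n j = real j"

definition e_oblivious :: "nat \<Rightarrow> nat \<Rightarrow> real" where
  "e_oblivious n j = (real n + 1) / 2"

definition random_input :: "nat \<Rightarrow> nat \<Rightarrow> nat list pmf" where
  "random_input N n = pmf_of_set {C. length C = N \<and> set C \<subseteq> {0..<2 ^ n}}"

definition expected_wkt :: "nat \<Rightarrow> nat \<Rightarrow> (nat \<Rightarrow> real) \<Rightarrow> real" where
  "expected_wkt N n e = measure_pmf.expectation (random_input N n) (\<lambda>C. wkt n C e)"

definition alpha_star :: "nat \<Rightarrow> nat \<Rightarrow> real" where
  "alpha_star N n = expected_wkt N n (e_oblivious n) / expected_wkt N n (e_aware n)"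

end

theory Submission
  imports Defs
begin

text \<open>
  Both expectations are estimated pair by pair, and the number of pairs cancels in the quotient.

  Upper bound for the aware vector: if \<open>u < w\<close> first differ at bit \<open>k\<close>, a wrong comparison needs a
  flip at some bit \<open>j \<ge> k\<close> of \<open>u\<close> or \<open>w\<close>, which has probability at most \<open>4 / 2 ^ k\<close>, while
  \<open>w - u < 2 ^ k\<close>; so \<open>(w - u) * Pr[error] \<le> 4\<close>. When a pivot separates \<open>u < v\<close> in the wrong
  order, the part of the gap \<open>v - u\<close> on either side of the pivot is paid for by a wrong comparison
  with the pivot, so each pivot contributes at most \<open>8\<close>, and a pair meets at most \<open>N\<close> pivots.

  Lower bound: only the first pivot \<open>p\<close> is used. If the three top bits of \<open>u\<close>, \<open>v\<close>, \<open>p\<close> are 011,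
  101 and 010, flipping only the top bit of \<open>v\<close> (and no other of these bits) sends \<open>v\<close> to the left
  and \<open>u\<close> to the right of \<open>p\<close>. The three patterns occur with probability \<open>1 / 512\<close>, and then
  \<open>v - u \<ge> 2 ^ (n - 3)\<close>, so a pair contributes at least a constant times \<open>2 ^ n * 2 powr (- e n)\<close>.
  The same estimate shows that the denominator is positive.
\<close>

section \<open>Noisy readings and the error of a single comparison\<close>

lemma noisy_read_Suc_conv_pair:
  "noisy_read e (Suc k) u =
     map_pmf (\<lambda>(r, f). r + (if f \<noteq> bit u k then 2 ^ k else 0))
       (pair_pmf (noisy_read e k u) (bernoulli_pmf (2 powr (- e (Suc k)))))"
  by (auto simp: pair_pmf_def map_bind_pmf intro!: bind_pmf_cong)

declare noisy_read.simps(2) [simp del]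

lemma noisy_read_less: "r \<in> set_pmf (noisy_read e k u) \<Longrightarrow> r < 2 ^ k"
proof (induction k arbitrary: r)
  case (Suc k)
  then obtain s f where "s \<in> set_pmf (noisy_read e k u)"
    and r: "r = s + (if f \<noteq> bit u k then 2 ^ k else 0)"
    by (auto simp: noisy_read_Suc_conv_pair)
  from Suc.IH[OF this(1)] show ?case by (simp add: r)
qed simp

lemma inexact_less_conv_pair:
  "inexact_less e n C x p =
     map_pmf (\<lambda>(r, s). r < s) (pair_pmf (noisy_read e n (C ! x)) (noisy_read e n (C ! p)))"
  by (auto simp: inexact_less_def pair_pmf_def map_bind_pmf intro!: bind_pmf_cong)

lemma prob_pair_pmf_fst:
  "measure_pmf.prob (pair_pmf M M') {x. P (fst x)} = measure_pmf.prob M {x. P x}"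
  using measure_map_pmf[of fst "pair_pmf M M'" "{x. P x}"]
  by (simp add: map_fst_pair_pmf vimage_def)

lemma prob_pair_pmf_snd:
  "measure_pmf.prob (pair_pmf M M') {x. P (snd x)} = measure_pmf.prob M' {x. P x}"
  using measure_map_pmf[of snd "pair_pmf M M'" "{x. P x}"]
  by (simp add: map_snd_pair_pmf vimage_def)

lemma prob_bernoulli_True:
  "0 \<le> p \<Longrightarrow> p \<le> 1 \<Longrightarrow> measure_pmf.prob (bernoulli_pmf p) {f. f} = p"
proof -
  assume "0 \<le> p" "p \<le> 1"
  moreover have "{f. f} = {True}" by auto
  ultimately show ?thesis by (simp add: measure_pmf_single)
qed

text \<open>The error probability of a comparison whose true answer is \<open>u < w\<close>. Ties
  are included, because equal readings make the strict test of \<open>inexact_less\<close>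
  fail.\<close>

definition misread :: "(nat \<Rightarrow> real) \<Rightarrow> nat \<Rightarrow> nat \<Rightarrow> nat \<Rightarrow> real" where
  "misread e k u w =
     measure_pmf.prob (pair_pmf (noisy_read e k u) (noisy_read e k w)) {x. snd x \<le> fst x}"

lemma misread_nonneg: "0 \<le> misread e k u w"
  by (simp add: misread_def)

text \<open>A union bound pays for a flip at position \<open>k\<close> in either item. Without such
  a flip, differing bits order the readings correctly, since by \<open>uw\<close> the set bit
  belongs to \<open>w\<close>; equal bits leave the decision to the lower \<open>k\<close>
  bits.\<close>

lemma misread_Suc:
  assumes e: "e (Suc k) \<ge> 0" and uw: "bit u k \<Longrightarrow> bit w k"
  shows "misread e (Suc k) u w \<le>
    2 * 2 powr (- e (Suc k)) + (if bit u k = bit w k then misread e k u w else 0)"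
proof -
  define p where "p = 2 powr (- e (Suc k))"
  have p: "0 \<le> p" "p \<le> 1" using e by (auto simp: p_def powr_minus field_simps ge_one_powr_ge_zero)
  define M where "M = pair_pmf (pair_pmf (noisy_read e k u) (bernoulli_pmf p))
                               (pair_pmf (noisy_read e k w) (bernoulli_pmf p))"
  define E where "E = {x :: (nat \<times> bool) \<times> (nat \<times> bool). bit u k = bit w k \<and> fst (snd x) \<le> fst (fst x)}"
  define g where "g = (\<lambda>v (r :: nat, f). r + (if f \<noteq> bit (v :: nat) k then 2 ^ k else 0))"
  have "noisy_read e (Suc k) v = map_pmf (g v) (pair_pmf (noisy_read e k v) (bernoulli_pmf p))" for v
    by (simp only: noisy_read_Suc_conv_pair g_def p_def)
  then have "pair_pmf (noisy_read e (Suc k) u) (noisy_read e (Suc k) w) = map_pmf (map_prod (g u) (g w)) M"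
    by (simp only: M_def map_prod_def map_pair)
  then have "misread e (Suc k) u w = measure_pmf.prob M {x. g w (snd x) \<le> g u (fst x)}"
    by (simp add: misread_def vimage_def map_prod_def split_beta)
  also have "\<dots> \<le> measure_pmf.prob M ({x. snd (fst x)} \<union> ({x. snd (snd x)} \<union> E))"
  proof (rule measure_pmf.finite_measure_mono_AE)
    \<comment> \<open>The inclusion holds only on the support: differing bits decide the comparison
      because the lower readings are below \<open>2 ^ k\<close>.\<close>
    show "AE x in measure_pmf M. x \<in> {x. g w (snd x) \<le> g u (fst x)} \<longrightarrow>
        x \<in> {x. snd (fst x)} \<union> ({x. snd (snd x)} \<union> E)"
      using uw
      by (auto simp: AE_measure_pmf_iff M_def E_def g_def dest!: noisy_read_less split: if_splits)
  qed simp
  also have "\<dots> \<le> measure_pmf.prob M {x. snd (fst x)} +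
      (measure_pmf.prob M {x. snd (snd x)} + measure_pmf.prob M E)"
    by (intro order.trans[OF measure_Un_le] add_left_mono) auto
  also have "measure_pmf.prob M {x. snd (fst x)} = p"
    unfolding M_def by (subst prob_pair_pmf_fst, subst prob_pair_pmf_snd) (simp add: prob_bernoulli_True p)
  also have "measure_pmf.prob M {x. snd (snd x)} = p"
    unfolding M_def by (subst prob_pair_pmf_snd, subst prob_pair_pmf_snd) (simp add: prob_bernoulli_True p)
  also have "measure_pmf.prob M E = (if bit u k = bit w k then misread e k u w else 0)"
  proof -
    have "map_pmf (map_prod fst fst) M = pair_pmf (noisy_read e k u) (noisy_read e k w)"
      unfolding M_def map_prod_def map_pair map_fst_pair_pmf ..
    then show ?thesis
      by (auto simp: E_def misread_def vimage_def map_prod_def split_beta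
               simp flip: \<open>map_pmf (map_prod fst fst) M = _\<close>)
  qed
  finally show ?thesis by (simp add: p_def)
qed

section \<open>Gap times error probability under the aware vector\<close>

lemma mod_2_power_Suc: "v mod 2 ^ Suc k = v mod 2 ^ k + (if bit v k then 2 ^ k else 0)" for v :: nat
proof -
  have "v mod (2 ^ k * 2) = 2 ^ k * (v div 2 ^ k mod 2) + v mod 2 ^ k" by (rule mod_mult2_eq)
  then show ?thesis by (auto simp: bit_iff_odd odd_iff_mod_2_eq_one mult.commute)
qed

text \<open>The summand \<open>2 / 2 ^ k\<close> pays for the flips of all bits above position \<open>k\<close>, so that the
  bound is preserved when a further bit is read on which \<open>u\<close> and \<open>w\<close> agree.\<close>

lemma misread_aware_weighted:
  assumes "u mod 2 ^ k < w mod 2 ^ k"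
  shows "(real (w mod 2 ^ k) - real (u mod 2 ^ k)) * (misread (e_aware n) k u w + 2 / 2 ^ k) \<le> 4"
  using assms
proof (induction k)
  case (Suc k)
  note md = mod_2_power_Suc[of _ k]
  have lt: "v mod 2 ^ k < 2 ^ k" for v :: nat by simp
  have uw: "bit w k" if "bit u k"
  proof (rule ccontr)
    assume "\<not> bit w k"
    then have "u mod 2 ^ k + 2 ^ k < w mod 2 ^ k" using Suc.prems that unfolding md by simp
    then show False using lt[of w] by linarith
  qed
  have pw: "2 powr (- e_aware n (Suc k)) = 1 / (2 * 2 ^ k)"
    unfolding e_aware_def powr_minus_divide using powr_realpow[of 2 "Suc k"] by simp
  have ms: "misread (e_aware n) (Suc k) u w \<le>
      1 / 2 ^ k + (if bit u k = bit w k then misread (e_aware n) k u w else 0)"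
    using misread_Suc[of "e_aware n" k u w] uw unfolding pw by (simp add: e_aware_def)
  show ?case
  proof (cases "bit u k = bit w k")
    case True
    then have d: "real (w mod 2 ^ Suc k) - real (u mod 2 ^ Suc k) = real (w mod 2 ^ k) - real (u mod 2 ^ k)"
      and l: "u mod 2 ^ k < w mod 2 ^ k"
      using Suc.prems unfolding md by auto
    \<comment> \<open>The two possible flips cost \<open>1 / 2 ^ k\<close> together, exactly the
      drop of the extra summand from \<open>2 / 2 ^ k\<close> to
      \<open>2 / 2 ^ Suc k\<close>.\<close>
    have "misread (e_aware n) (Suc k) u w + 2 / 2 ^ Suc k \<le> misread (e_aware n) k u w + 2 / 2 ^ k"
      using ms True by simp
    then have "(real (w mod 2 ^ k) - real (u mod 2 ^ k)) * (misread (e_aware n) (Suc k) u w + 2 / 2 ^ Suc k)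
       \<le> (real (w mod 2 ^ k) - real (u mod 2 ^ k)) * (misread (e_aware n) k u w + 2 / 2 ^ k)"
      using l by (intro mult_left_mono) auto
    also have "\<dots> \<le> 4" by (rule Suc.IH[OF l])
    finally show ?thesis unfolding d .
  next
    case False
    have "w mod 2 ^ Suc k < 2 ^ Suc k" by simp
    then have "real (w mod 2 ^ Suc k) < real (2 ^ Suc k)" by (simp only: of_nat_less_iff)
    then have "real (w mod 2 ^ Suc k) - real (u mod 2 ^ Suc k) \<le> 2 ^ Suc k" by simp
    \<comment> \<open>With differing bits only the flips count:
      \<open>1 / 2 ^ k + 2 / 2 ^ Suc k = 4 / 2 ^ Suc k\<close>, which balances a gap of at most
      \<open>2 ^ Suc k\<close>.\<close>
    moreover have "misread (e_aware n) (Suc k) u w + 2 / 2 ^ Suc k \<le> 4 / 2 ^ Suc k"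
      using ms False by (simp add: field_simps)
    ultimately have "(real (w mod 2 ^ Suc k) - real (u mod 2 ^ Suc k)) *
        (misread (e_aware n) (Suc k) u w + 2 / 2 ^ Suc k) \<le> 2 ^ Suc k * (4 / 2 ^ Suc k)"
      by (intro mult_mono) (auto intro: add_nonneg_nonneg misread_nonneg)
    then show ?thesis by simp
  qed
qed simp

lemma misread_aware:
  assumes "u < w" "w < 2 ^ n"
  shows "(real w - real u) * misread (e_aware n) n u w \<le> 4"
proof -
  have "(real w - real u) * misread (e_aware n) n u w \<le>
        (real w - real u) * (misread (e_aware n) n u w + 2 / 2 ^ n)"
    using assms by (intro mult_left_mono) auto
  also have "\<dots> \<le> 4" using misread_aware_weighted[of u n w n] assms by simp
  finally show ?thesis .
qed

lemma inexact_less_False: "pmf (inexact_less e n C x p) False = misread e n (C ! x) (C ! p)"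
  by (simp add: inexact_less_conv_pair misread_def pmf_map vimage_def split_beta not_less)

text \<open>The answer \<open>True\<close> requires a strict inequality of the readings, whereas
  \<open>misread\<close> counts ties as well; hence an inequality, unlike for the answer
  \<open>False\<close>.\<close>

lemma inexact_less_True: "pmf (inexact_less e n C x p) True \<le> misread e n (C ! p) (C ! x)"
proof -
  have "pmf (inexact_less e n C x p) True =
     measure_pmf.prob (pair_pmf (noisy_read e n (C ! p)) (noisy_read e n (C ! x))) {x. snd x < fst x}"
    by (subst pair_commute_pmf)
       (simp add: inexact_less_conv_pair pmf_map vimage_def split_beta)
  also have "\<dots> \<le> misread e n (C ! p) (C ! x)"
    unfolding misread_def by (intro measure_pmf.finite_measure_mono) auto
  finally show ?thesis .
qed

section \<open>Quicksort permutes its input; the law of the sides in a partition\<close>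

lemma partition_pmf_mset:
  "lr \<in> set_pmf (partition_pmf lt p xs) \<Longrightarrow> mset (fst lr) + mset (snd lr) = mset xs"
  by (induction xs arbitrary: lr) (auto split: if_splits)

declare quicksort_pmf.simps [simp del]

lemma quicksort_pmf_mset: "ys \<in> set_pmf (quicksort_pmf lt xs) \<Longrightarrow> mset ys = mset xs"
proof (induction "length xs" arbitrary: xs ys rule: less_induct)
  case less
  show ?case
  proof (cases "xs = []")
    case True
    then show ?thesis using less.prems by (simp add: quicksort_pmf.simps)
  next
    case False
    then obtain i lr sl sr where i: "i < length xs"
      and lr: "lr \<in> set_pmf (partition_pmf lt (xs ! i) (take i xs @ drop (Suc i) xs))"
      and sl: "sl \<in> set_pmf (quicksort_pmf lt (fst lr))"
      and sr: "sr \<in> set_pmf (quicksort_pmf lt (snd lr))"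
      and ys: "ys = sl @ xs ! i # sr"
      using less.prems by (subst (asm) quicksort_pmf.simps) (auto simp: set_pmf_of_set)
    have len: "length (fst lr) < length xs" "length (snd lr) < length xs"
      using partition_pmf_length[OF lr] i by auto
    have "mset ys = mset (fst lr) + mset (snd lr) + {#xs ! i#}"
      using less.hyps[OF len(1) sl] less.hyps[OF len(2) sr] by (simp add: ys)
    also have "\<dots> = mset (take i xs @ xs ! i # drop (Suc i) xs)"
      using partition_pmf_mset[OF lr] by simp
    finally show ?thesis using i by (simp flip: id_take_nth_drop)
  qed
qed

text \<open>As \<open>a\<close> occurs once, its side is decided by its own comparison with the
  pivot alone, and the other comparisons integrate out.\<close>

lemma partition_pmf_mem_fst:
  assumes "distinct xs" "a \<in> set xs"
  shows "map_pmf (\<lambda>lr. a \<in> set (fst lr)) (partition_pmf lt p xs) = lt a p"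
  using assms
proof (induction xs)
  case (Cons x xs)
  show ?case
  proof (cases "x = a")
    case True
    have "a \<notin> set (fst lr)" if "lr \<in> set_pmf (partition_pmf lt p xs)" for lr
      using partition_pmf_mset[OF that, THEN arg_cong, of set_mset] Cons.prems True by auto
    then have "map_pmf (\<lambda>lr. a \<in> set (fst lr)) (partition_pmf lt p (x # xs)) =
       bind_pmf (lt a p) (\<lambda>b. bind_pmf (partition_pmf lt p xs) (\<lambda>_. return_pmf b))"
      by (auto simp: True map_bind_pmf simp del: bind_pmf_const intro!: bind_pmf_cong)
    then show ?thesis by (simp add: bind_return_pmf')
  next
    case False
    then have "map_pmf (\<lambda>lr. a \<in> set (fst lr)) (partition_pmf lt p (x # xs)) =
       bind_pmf (lt x p) (\<lambda>b. map_pmf (\<lambda>lr. a \<in> set (fst lr)) (partition_pmf lt p xs))"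
      by (auto simp: map_bind_pmf map_pmf_def[of _ "partition_pmf lt p xs"]
               simp del: bind_pmf_const intro!: bind_pmf_cong)
    then show ?thesis using Cons False by simp
  qed
qed simp

text \<open>Every comparison draws fresh randomness, so the sides of two distinct elements are
  independent.\<close>

lemma partition_pmf_mem_fst_pair:
  assumes "distinct xs" "a \<in> set xs" "b \<in> set xs" "a \<noteq> b"
  shows "map_pmf (\<lambda>lr. (a \<in> set (fst lr), b \<in> set (fst lr))) (partition_pmf lt p xs) =
         pair_pmf (lt a p) (lt b p)"
  using assms
proof (induction xs)
  case (Cons x xs)
  have nin: "x \<notin> set (fst lr)" if "lr \<in> set_pmf (partition_pmf lt p xs)" for lr
    using partition_pmf_mset[OF that, THEN arg_cong, of set_mset] Cons.prems by auto
  consider "x = a" | "x = b" | "x \<noteq> a" "x \<noteq> b" by blast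
  then show ?case
  proof cases
    case 1
    then have "map_pmf (\<lambda>lr. (a \<in> set (fst lr), b \<in> set (fst lr))) (partition_pmf lt p (x # xs)) =
       bind_pmf (lt a p) (\<lambda>c. bind_pmf (map_pmf (\<lambda>lr. b \<in> set (fst lr)) (partition_pmf lt p xs))
         (\<lambda>d. return_pmf (c, d)))"
      using nin Cons.prems by (auto simp: map_bind_pmf bind_map_pmf intro!: bind_pmf_cong)
    then show ?thesis using 1 Cons.prems by (simp add: partition_pmf_mem_fst pair_pmf_def)
  next
    case 2
    then have "map_pmf (\<lambda>lr. (a \<in> set (fst lr), b \<in> set (fst lr))) (partition_pmf lt p (x # xs)) =
       bind_pmf (lt b p) (\<lambda>d. bind_pmf (map_pmf (\<lambda>lr. a \<in> set (fst lr)) (partition_pmf lt p xs))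
         (\<lambda>c. return_pmf (c, d)))"
      using nin Cons.prems by (auto simp: map_bind_pmf bind_map_pmf intro!: bind_pmf_cong)
    \<comment> \<open>Here \<open>b\<close> is met before \<open>a\<close>, so the two independent
      draws have to be commuted.\<close>
    also have "\<dots> = pair_pmf (lt a p) (lt b p)"
      using 2 Cons.prems by (simp add: partition_pmf_mem_fst pair_pmf_def bind_commute_pmf[of "lt b p"])
    finally show ?thesis .
  next
    case 3
    then have "map_pmf (\<lambda>lr. (a \<in> set (fst lr), b \<in> set (fst lr))) (partition_pmf lt p (x # xs)) =
       bind_pmf (lt x p) (\<lambda>_. map_pmf (\<lambda>lr. (a \<in> set (fst lr), b \<in> set (fst lr))) (partition_pmf lt p xs))"
      by (auto simp: map_bind_pmf map_pmf_def[of _ "partition_pmf lt p xs"]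
               simp del: bind_pmf_const intro!: bind_pmf_cong)
    then show ?thesis using Cons 3 by simp
  qed
qed simp

section \<open>Precedence in the output and probabilities of two-stage experiments\<close>

text \<open>A recursive counterpart of the index condition in \<open>misordered\<close>, suited to
  the concatenations that quicksort builds.\<close>

fun precedes :: "'a \<Rightarrow> 'a \<Rightarrow> 'a list \<Rightarrow> bool" where
  "precedes y x [] \<longleftrightarrow> False"
| "precedes y x (z # zs) \<longleftrightarrow> z = y \<and> x \<in> set zs \<or> precedes y x zs"

lemma precedes_append:
  "precedes y x (xs @ ys) \<longleftrightarrow> precedes y x xs \<or> precedes y x ys \<or> y \<in> set xs \<and> x \<in> set ys"
  by (induction xs) auto

lemma precedes_set: "precedes y x zs \<Longrightarrow> x \<in> set zs \<and> y \<in> set zs"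
  by (induction zs) auto

lemma precedes_conv_nth:
  "precedes y x zs \<longleftrightarrow> (\<exists>i<length zs. \<exists>j<length zs. i < j \<and> zs ! i = y \<and> zs ! j = x)"
proof (induction zs)
  case (Cons z zs)
  have "(\<exists>i<length (z # zs). \<exists>j<length (z # zs). i < j \<and> (z # zs) ! i = y \<and> (z # zs) ! j = x) \<longleftrightarrow>
    z = y \<and> (\<exists>j<length zs. zs ! j = x) \<or>
    (\<exists>i<length zs. \<exists>j<length zs. i < j \<and> zs ! i = y \<and> zs ! j = x)"
    by (auto simp: Ex_less_Suc2)
  then show ?case by (simp add: Cons.IH in_set_conv_nth)
qed simp

lemma misordered_conv_precedes:
  "misordered C a b out \<longleftrightarrow>
     precedes a b out \<and> C ! b < C ! a \<or> precedes b a out \<and> C ! a < C ! b"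
  unfolding misordered_def precedes_conv_nth by blast

lemma prob_bind_pmf:
  "measure_pmf.prob (bind_pmf M f) A = measure_pmf.expectation M (\<lambda>x. measure_pmf.prob (f x) A)"
proof -
  have *: "measure_pmf.prob N A = pmf (map_pmf (\<lambda>x. x \<in> A) N) True" for N
    by (simp add: pmf_map vimage_def)
  show ?thesis unfolding * map_bind_pmf pmf_bind ..
qed

text \<open>The first stage is charged the full weight \<open>D\<close> on the bad event
  \<open>E\<close>, and \<open>B\<close> bounds the rest. For the choice of the pivot
  \<open>E\<close> is taken empty; for the partition it is the wrong separation of the pair.\<close>

lemma prob_bind_pmf_le:
  assumes "0 \<le> D"
    and "\<And>x. x \<in> set_pmf M \<Longrightarrow> D * measure_pmf.prob (f x) A \<le> D * indicator E x + B"
  shows "D * measure_pmf.prob (bind_pmf M f) A \<le> D * measure_pmf.prob M E + B"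
proof -
  have int: "integrable (measure_pmf M) (\<lambda>x. measure_pmf.prob (f x) A)"
    by (rule measure_pmf.integrable_const_bound[where B = 1]) auto
  have "D * measure_pmf.prob (bind_pmf M f) A =
      measure_pmf.expectation M (\<lambda>x. D * measure_pmf.prob (f x) A)"
    by (simp add: prob_bind_pmf)
  also have "\<dots> \<le> measure_pmf.expectation M (\<lambda>x. D * indicator E x + B)"
    using assms int
    by (intro integral_mono_AE Bochner_Integration.integrable_add integrable_mult_right
              integrable_const integrable_real_indicator)
       (auto simp: AE_measure_pmf_iff measure_pmf.emeasure_eq_measure)
  also have "\<dots> = D * measure_pmf.prob M E + B"
    by (subst Bochner_Integration.integral_add)
       (auto intro!: integrable_real_indicator simp: measure_pmf.emeasure_eq_measure)
  finally show ?thesis .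
qed

lemma prob_le_prob_bind_pmf:
  assumes "\<And>x. x \<in> set_pmf M \<Longrightarrow> x \<in> E \<Longrightarrow> measure_pmf.prob (f x) A = 1"
  shows "measure_pmf.prob M E \<le> measure_pmf.prob (bind_pmf M f) A"
proof -
  have int: "integrable (measure_pmf M) (\<lambda>x. measure_pmf.prob (f x) A)"
    by (rule measure_pmf.integrable_const_bound[where B = 1]) auto
  have "measure_pmf.prob M E = measure_pmf.expectation M (indicator E)" by simp
  also have "\<dots> \<le> measure_pmf.expectation M (\<lambda>x. measure_pmf.prob (f x) A)"
    using assms int
    by (intro integral_mono_AE integrable_real_indicator)
       (auto simp: AE_measure_pmf_iff indicator_def measure_pmf.emeasure_eq_measure)
  finally show ?thesis by (simp add: prob_bind_pmf)
qed

section \<open>Side probabilities in terms of single comparisons\<close>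

lemma partition_pmf_prob_fst:
  assumes "distinct xs" "a \<in> set xs"
  shows "measure_pmf.prob (partition_pmf lt p xs) {lr. a \<in> set (fst lr)} = pmf (lt a p) True"
  by (simp add: pmf_map vimage_def flip: partition_pmf_mem_fst[OF assms])

lemma partition_pmf_mem_iff:
  assumes "distinct xs" "a \<in> set xs" "lr \<in> set_pmf (partition_pmf lt p xs)"
  shows "a \<in> set (snd lr) \<longleftrightarrow> a \<notin> set (fst lr)"
proof -
  have m: "mset (fst lr @ snd lr) = mset xs" using partition_pmf_mset[OF assms(3)] by simp
  have "distinct (fst lr @ snd lr)" using mset_eq_imp_distinct_iff[OF m] assms by simp
  moreover have "set (fst lr @ snd lr) = set xs" using mset_eq_setD[OF m] .
  ultimately show ?thesis using assms(2) by auto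
qed

lemma partition_pmf_prob_snd:
  assumes "distinct xs" "a \<in> set xs"
  shows "measure_pmf.prob (partition_pmf lt p xs) {lr. a \<in> set (snd lr)} = pmf (lt a p) False"
proof -
  have "measure_pmf.prob (partition_pmf lt p xs) {lr. a \<in> set (snd lr)} =
        measure_pmf.prob (partition_pmf lt p xs) {lr. a \<notin> set (fst lr)}"
    using assms by (intro measure_pmf.finite_measure_eq_AE) (auto simp: AE_measure_pmf_iff partition_pmf_mem_iff)
  also have "\<dots> = pmf (lt a p) False"
    by (simp add: pmf_map vimage_def flip: partition_pmf_mem_fst[OF assms])
  finally show ?thesis .
qed

lemma partition_pmf_prob_fst_snd:
  assumes "distinct xs" "a \<in> set xs" "b \<in> set xs" "a \<noteq> b"
  shows "measure_pmf.prob (partition_pmf lt p xs) {lr. b \<in> set (fst lr) \<and> a \<in> set (snd lr)} =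
         pmf (lt b p) True * pmf (lt a p) False"
proof -
  have "measure_pmf.prob (partition_pmf lt p xs) {lr. b \<in> set (fst lr) \<and> a \<in> set (snd lr)} =
        measure_pmf.prob (partition_pmf lt p xs) {lr. a \<notin> set (fst lr) \<and> b \<in> set (fst lr)}"
    using assms by (intro measure_pmf.finite_measure_eq_AE) (auto simp: AE_measure_pmf_iff partition_pmf_mem_iff)
  also have "\<dots> = pmf (pair_pmf (lt a p) (lt b p)) (False, True)"
    by (simp add: pmf_map vimage_def del: pmf_pair flip: partition_pmf_mem_fst_pair[OF assms])
  finally show ?thesis by (simp add: pmf_pair)
qed

section \<open>Upper bound for the misplacement of a pair\<close>

text \<open>What remains once pivot and partition are fixed. The recursive calls form an independent
  pair, so that either one can be projected out.\<close>

definition quicksort_combine ::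
  "('a \<Rightarrow> 'a \<Rightarrow> bool pmf) \<Rightarrow> 'a \<Rightarrow> 'a list \<times> 'a list \<Rightarrow> 'a list pmf" where
  "quicksort_combine lt p lr =
     map_pmf (\<lambda>s. fst s @ p # snd s) (pair_pmf (quicksort_pmf lt (fst lr)) (quicksort_pmf lt (snd lr)))"

lemma quicksort_pmf_conv_combine:
  assumes "xs \<noteq> []"
  shows "quicksort_pmf lt xs =
    bind_pmf (pmf_of_set {0..<length xs}) (\<lambda>i.
      bind_pmf (partition_pmf lt (xs ! i) (take i xs @ drop (Suc i) xs)) (quicksort_combine lt (xs ! i)))"
  using assms
  by (subst quicksort_pmf.simps)
     (auto simp: quicksort_combine_def[abs_def] pair_pmf_def map_bind_pmf intro!: bind_pmf_cong)

text \<open>The third hypothesis says that the pivot has not put \<open>b\<close> before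
  \<open>a\<close>. Then \<open>b\<close> can precede \<open>a\<close> only if both lie on the same
  side, and the recursive call on that side decides.\<close>

lemma quicksort_combine_precedes_le:
  assumes "distinct (p # fst lr @ snd lr)" "a \<noteq> b"
    and "\<not> ((b \<in> set (fst lr) \<or> p = b) \<and> (a \<in> set (snd lr) \<or> p = a))"
    and "a \<in> set (fst lr) \<Longrightarrow> b \<in> set (fst lr) \<Longrightarrow>
       measure_pmf.prob (quicksort_pmf lt (fst lr)) {out. precedes b a out} \<le> B"
    and "a \<in> set (snd lr) \<Longrightarrow> b \<in> set (snd lr) \<Longrightarrow>
       measure_pmf.prob (quicksort_pmf lt (snd lr)) {out. precedes b a out} \<le> B"
    and "0 \<le> B"
  shows "measure_pmf.prob (quicksort_combine lt p lr) {out. precedes b a out} \<le> B"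
proof -
  define M where "M = pair_pmf (quicksort_pmf lt (fst lr)) (quicksort_pmf lt (snd lr))"
  have sets: "set (fst s) = set (fst lr) \<and> set (snd s) = set (snd lr)" if "s \<in> set_pmf M" for s
    using that by (auto simp: M_def dest!: quicksort_pmf_mset mset_eq_setD)
  have prob: "measure_pmf.prob (quicksort_combine lt p lr) {out. precedes b a out} =
        measure_pmf.prob M {s. precedes b a (fst s @ p # snd s)}"
    by (simp add: quicksort_combine_def M_def vimage_def)
  have step: "precedes b a (fst s) \<and> a \<in> set (fst lr) \<and> b \<in> set (fst lr) \<or>
      precedes b a (snd s) \<and> a \<in> set (snd lr) \<and> b \<in> set (snd lr)"
    if "s \<in> set_pmf M" "precedes b a (fst s @ p # snd s)" for s
    using that(2) sets[OF that(1)] assms(2,3)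
    by (auto simp: precedes_append dest: precedes_set)
  consider "a \<in> set (fst lr)" "b \<in> set (fst lr)" | "a \<in> set (snd lr)" "b \<in> set (snd lr)"
    | "\<not> (a \<in> set (fst lr) \<and> b \<in> set (fst lr))" "\<not> (a \<in> set (snd lr) \<and> b \<in> set (snd lr))"
    by blast
  then show ?thesis
  proof cases
    case 1
    then have "a \<notin> set (snd lr)" using assms(1) by auto
    then have "measure_pmf.prob M {s. precedes b a (fst s @ p # snd s)} \<le>
        measure_pmf.prob M {s. precedes b a (fst s)}"
      using step by (intro measure_pmf.finite_measure_mono_AE) (auto simp: AE_measure_pmf_iff)
    also have "\<dots> \<le> B" unfolding M_def prob_pair_pmf_fst by (rule assms(4)[OF 1])
    finally show ?thesis unfolding prob .
  next
    case 2
    then have "a \<notin> set (fst lr)" using assms(1) by auto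
    then have "measure_pmf.prob M {s. precedes b a (fst s @ p # snd s)} \<le>
        measure_pmf.prob M {s. precedes b a (snd s)}"
      using step by (intro measure_pmf.finite_measure_mono_AE) (auto simp: AE_measure_pmf_iff)
    also have "\<dots> \<le> B" unfolding M_def prob_pair_pmf_snd by (rule assms(5)[OF 2])
    finally show ?thesis unfolding prob .
  next
    case 3
    then have "measure_pmf.prob M {s. precedes b a (fst s @ p # snd s)} \<le> measure_pmf.prob M {}"
      using step by (intro measure_pmf.finite_measure_mono_AE) (auto simp: AE_measure_pmf_iff)
    then show ?thesis unfolding prob using assms(6) by simp
  qed
qed

text \<open>Split the gap as \<open>(val b - val p) + (val p - val a)\<close>. If \<open>p\<close>
  lies below \<open>b\<close>, the event needs \<open>b\<close> to be sent left wrongly; if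
  \<open>p\<close> lies above \<open>a\<close>, it needs \<open>a\<close> to be sent right wrongly.
  Each such part costs at most \<open>K\<close>, and a part that is not positive is bounded by
  \<open>0 \<le> K\<close>. This also covers pivots outside the gap and \<open>p\<close> equal to
  \<open>a\<close> or \<open>b\<close>.\<close>

lemma partition_pmf_separation_weighted:
  fixes val :: "'a \<Rightarrow> real"
  assumes lt: "\<And>x p. x \<in> A \<Longrightarrow> p \<in> A \<Longrightarrow> val x < val p \<Longrightarrow> (val p - val x) * pmf (lt x p) False \<le> K"
    and gt: "\<And>x p. x \<in> A \<Longrightarrow> p \<in> A \<Longrightarrow> val p < val x \<Longrightarrow> (val x - val p) * pmf (lt x p) True \<le> K"
    and A: "p \<in> A" "set xs \<subseteq> A" and xs: "distinct (p # xs)" and K: "0 \<le> K"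
    and ab: "a \<in> set (p # xs)" "b \<in> set (p # xs)" "val a < val b"
  shows "(val b - val a) * measure_pmf.prob (partition_pmf lt p xs)
    {lr. (b \<in> set (fst lr) \<or> p = b) \<and> (a \<in> set (snd lr) \<or> p = a)} \<le> 2 * K"
    (is "_ * measure_pmf.prob ?M ?E \<le> _")
proof -
  have F: "(val b - val p) * measure_pmf.prob ?M ?E \<le> K" if "val p < val b"
  proof -
    have b: "b \<in> set xs" using that ab by auto
    have "measure_pmf.prob ?M ?E \<le> measure_pmf.prob ?M {lr. b \<in> set (fst lr)}"
      using that by (intro measure_pmf.finite_measure_mono) auto
    also have "\<dots> = pmf (lt b p) True" using xs b by (simp add: partition_pmf_prob_fst)
    finally have "(val b - val p) * measure_pmf.prob ?M ?E \<le> (val b - val p) * pmf (lt b p) True"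
      using that by (intro mult_left_mono) auto
    also have "\<dots> \<le> K" using gt[of b p] that b A by auto
    finally show ?thesis .
  qed
  have G: "(val p - val a) * measure_pmf.prob ?M ?E \<le> K" if "val a < val p"
  proof -
    have a: "a \<in> set xs" using that ab by auto
    have "measure_pmf.prob ?M ?E \<le> measure_pmf.prob ?M {lr. a \<in> set (snd lr)}"
      using that by (intro measure_pmf.finite_measure_mono) auto
    also have "\<dots> = pmf (lt a p) False" using xs a by (simp add: partition_pmf_prob_snd)
    finally have "(val p - val a) * measure_pmf.prob ?M ?E \<le> (val p - val a) * pmf (lt a p) False"
      using that by (intro mult_left_mono) auto
    also have "\<dots> \<le> K" using lt[of a p] that a A by auto
    finally show ?thesis .
  qed
  have "(val b - val p) * measure_pmf.prob ?M ?E \<le> K"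
    using F K by (cases "val p < val b") (auto intro: order.trans[OF mult_nonpos_nonneg])
  moreover have "(val p - val a) * measure_pmf.prob ?M ?E \<le> K"
    using G K by (cases "val a < val p") (auto intro: order.trans[OF mult_nonpos_nonneg])
  ultimately show ?thesis by (simp add: algebra_simps)
qed

text \<open>Induction on the length: a pivot separates the pair wrongly at weighted cost at most
  \<open>2 * K\<close>; otherwise the pair is already in the right order or stays together in a list
  shorter by at least one.\<close>

lemma quicksort_precedes_weighted:
  fixes val :: "'a \<Rightarrow> real"
  assumes lt: "\<And>x p. x \<in> A \<Longrightarrow> p \<in> A \<Longrightarrow> val x < val p \<Longrightarrow> (val p - val x) * pmf (lt x p) False \<le> K"
    and gt: "\<And>x p. x \<in> A \<Longrightarrow> p \<in> A \<Longrightarrow> val p < val x \<Longrightarrow> (val x - val p) * pmf (lt x p) True \<le> K"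
    and K: "0 \<le> K" and ab: "val a < val b"
    and xs: "distinct xs" "set xs \<subseteq> A" "a \<in> set xs" "b \<in> set xs"
  shows "(val b - val a) * measure_pmf.prob (quicksort_pmf lt xs) {out. precedes b a out}
     \<le> 2 * K * real (length xs)"
  using xs
proof (induction "length xs" arbitrary: xs rule: less_induct)
  case less
  define D where "D = val b - val a"
  have D: "0 < D" using ab by (simp add: D_def)
  have ne: "xs \<noteq> []" using less.prems by auto
  \<comment> \<open>The bound is shown for every pivot separately, so the event charged to the
    choice of the pivot is empty.\<close>
  have "D * measure_pmf.prob (quicksort_pmf lt xs) {out. precedes b a out} \<le>
    D * measure_pmf.prob (pmf_of_set {0..<length xs}) {} + 2 * K * real (length xs)"
    unfolding quicksort_pmf_conv_combine[OF ne]
  proof (rule prob_bind_pmf_le)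
    fix i assume "i \<in> set_pmf (pmf_of_set {0..<length xs})"
    then have i: "i < length xs" using ne by (simp add: set_pmf_of_set)
    define p where "p = xs ! i"
    define ys where "ys = take i xs @ drop (Suc i) xs"
    define E where "E = {lr. (b \<in> set (fst lr) \<or> p = b) \<and> (a \<in> set (snd lr) \<or> p = a)}"
    have "mset (take i xs @ xs ! i # drop (Suc i) xs) = mset xs"
      using i by (simp flip: id_take_nth_drop)
    then have m: "mset (p # ys) = mset xs" by (simp add: p_def ys_def)
    have d: "distinct (p # ys)" using mset_eq_imp_distinct_iff[OF m] less.prems by simp
    have s: "set (p # ys) = set xs" using mset_eq_setD[OF m] .
    have len: "length xs = Suc (length ys)" using arg_cong[OF m, of size] by simp
    have "D * measure_pmf.prob (bind_pmf (partition_pmf lt p ys) (quicksort_combine lt p)) {out. precedes b a out}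
        \<le> D * measure_pmf.prob (partition_pmf lt p ys) E + 2 * K * real (length ys)"
    proof (rule prob_bind_pmf_le)
      fix lr assume lr: "lr \<in> set_pmf (partition_pmf lt p ys)"
      have m': "mset (p # fst lr @ snd lr) = mset (p # ys)" using partition_pmf_mset[OF lr] by simp
      have d': "distinct (p # fst lr @ snd lr)" using mset_eq_imp_distinct_iff[OF m'] d by simp
      have s': "set (p # fst lr @ snd lr) = set (p # ys)" using mset_eq_setD[OF m'] .
      have l': "length (fst lr) + length (snd lr) = length ys" by (rule partition_pmf_length[OF lr])
      show "D * measure_pmf.prob (quicksort_combine lt p lr) {out. precedes b a out} \<le>
          D * indicator E lr + 2 * K * real (length ys)"
      proof (cases "lr \<in> E")
        case True
        have "D * measure_pmf.prob (quicksort_combine lt p lr) {out. precedes b a out} \<le> D * 1"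
          using D by (intro mult_left_mono) auto
        also have "\<dots> \<le> D * indicator E lr + 2 * K * real (length ys)" using True K by simp
        finally show ?thesis .
      next
        case False
        \<comment> \<open>The induction hypothesis divided by \<open>D\<close>, a bound that serves
          both sides of the partition.\<close>
        have rec: "measure_pmf.prob (quicksort_pmf lt zs) {out. precedes b a out} \<le> 2 * K * real (length ys) / D"
          if "length zs \<le> length ys" "distinct zs" "set zs \<subseteq> set xs" "a \<in> set zs" "b \<in> set zs" for zs
        proof -
          have "D * measure_pmf.prob (quicksort_pmf lt zs) {out. precedes b a out} \<le> 2 * K * real (length zs)"
            unfolding D_def using that less.prems len by (intro less.hyps) auto
          also have "\<dots> \<le> 2 * K * real (length ys)" using that K by (intro mult_left_mono) auto
          finally show ?thesis using D by (simp add: field_simps)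
        qed
        have "measure_pmf.prob (quicksort_combine lt p lr) {out. precedes b a out} \<le> 2 * K * real (length ys) / D"
        proof (rule quicksort_combine_precedes_le)
          show "distinct (p # fst lr @ snd lr)" by (rule d')
          show "a \<noteq> b" using ab by auto
          show "\<not> ((b \<in> set (fst lr) \<or> p = b) \<and> (a \<in> set (snd lr) \<or> p = a))"
            using False by (simp add: E_def)
          show "0 \<le> 2 * K * real (length ys) / D" using K D by simp
        qed (use rec[of "fst lr"] rec[of "snd lr"] l' d' s' s in auto)
        then show ?thesis using False D by (simp add: field_simps)
      qed
    qed (use D in simp)
    also have "D * measure_pmf.prob (partition_pmf lt p ys) E \<le> 2 * K"
      unfolding D_def E_def using s less.prems d ab K
      by (intro partition_pmf_separation_weighted[of A val lt K]) (auto intro: lt gt)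
    finally show "D * measure_pmf.prob
        (bind_pmf (partition_pmf lt (xs ! i) (take i xs @ drop (Suc i) xs)) (quicksort_combine lt (xs ! i)))
        {out. precedes b a out} \<le> D * indicator {} i + 2 * K * real (length xs)"
      by (simp add: p_def ys_def[symmetric] len algebra_simps)
  qed (use D in simp)
  then show ?case by (simp add: D_def)
qed

section \<open>Lower bound from the first pivot\<close>

text \<open>Each \<open>p\<close> is the first pivot with probability \<open>1 / length xs\<close>.
  If it sends \<open>b\<close> left and \<open>a\<close> right, then \<open>b\<close> precedes
  \<open>a\<close> whatever the recursive calls do.\<close>

lemma quicksort_precedes_ge:
  assumes xs: "distinct xs" "a \<in> set xs" "b \<in> set xs" "a \<noteq> b"
  shows "(\<Sum>p \<in> set xs - {a, b}. pmf (lt b p) True * pmf (lt a p) False) / real (length xs)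
    \<le> measure_pmf.prob (quicksort_pmf lt xs) {out. precedes b a out}"
proof -
  have ne: "xs \<noteq> []" using xs by auto
  \<comment> \<open>The value 0 at \<open>a\<close> and \<open>b\<close> lets the sum run over all
    elements, so that it can be reindexed by pivot positions.\<close>
  define f where "f p = (if p \<in> {a, b} then 0 else pmf (lt b p) True * pmf (lt a p) False)" for p
  define G where "G i = bind_pmf (partition_pmf lt (xs ! i) (take i xs @ drop (Suc i) xs))
    (quicksort_combine lt (xs ! i))" for i
  have G: "f (xs ! i) \<le> measure_pmf.prob (G i) {out. precedes b a out}" if i: "i < length xs" for i
  proof (cases "xs ! i \<in> {a, b}")
    case False
    define p where "p = xs ! i"
    define ys where "ys = take i xs @ drop (Suc i) xs"
    have "mset (take i xs @ xs ! i # drop (Suc i) xs) = mset xs"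
      using i by (simp flip: id_take_nth_drop)
    then have m: "mset (p # ys) = mset xs" by (simp add: p_def ys_def)
    have d: "distinct (p # ys)" using mset_eq_imp_distinct_iff[OF m] xs by simp
    have s: "set (p # ys) = set xs" using mset_eq_setD[OF m] .
    have ab: "a \<in> set ys" "b \<in> set ys" using s[symmetric] xs False by (auto simp: p_def)
    have "f (xs ! i) = measure_pmf.prob (partition_pmf lt p ys) {lr. b \<in> set (fst lr) \<and> a \<in> set (snd lr)}"
      using False d ab xs by (subst partition_pmf_prob_fst_snd) (auto simp: f_def p_def)
    also have "\<dots> \<le> measure_pmf.prob (bind_pmf (partition_pmf lt p ys) (quicksort_combine lt p)) {out. precedes b a out}"
    proof (rule prob_le_prob_bind_pmf)
      fix lr assume "lr \<in> {lr. b \<in> set (fst lr) \<and> a \<in> set (snd lr)}"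
      then show "measure_pmf.prob (quicksort_combine lt p lr) {out. precedes b a out} = 1"
        by (subst measure_pmf.prob_eq_1)
           (auto simp: AE_measure_pmf_iff quicksort_combine_def precedes_append
             dest!: quicksort_pmf_mset mset_eq_setD)
    qed
    finally show ?thesis by (simp add: G_def p_def ys_def)
  qed (simp add: f_def)
  have "(\<Sum>p \<in> set xs - {a, b}. pmf (lt b p) True * pmf (lt a p) False) = (\<Sum>p \<in> set xs. f p)"
    by (rule sum.mono_neutral_cong_left) (auto simp: f_def)
  also have "\<dots> = (\<Sum>i<length xs. f (xs ! i))"
    using sum.reindex_bij_betw[OF bij_betw_nth[OF xs(1) refl refl], of f] by simp
  also have "\<dots> \<le> (\<Sum>i<length xs. measure_pmf.prob (G i) {out. precedes b a out})"
    using G by (intro sum_mono) auto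
  finally show ?thesis
    using ne unfolding quicksort_pmf_conv_combine[OF ne] G_def[symmetric]
    by (simp add: prob_bind_pmf integral_pmf_of_set lessThan_atLeast0 divide_right_mono)
qed

section \<open>Lower bounds for readings of the top bits\<close>

text \<open>Keep only the outcomes with flip flag \<open>f\<close>, which is independent of the
  lower bits.\<close>

lemma noisy_read_Suc_ge:
  "pmf (bernoulli_pmf (2 powr (- e (Suc k)))) f *
     measure_pmf.prob (noisy_read e k u) {r. r + (if f \<noteq> bit u k then 2 ^ k else 0) \<in> A}
   \<le> measure_pmf.prob (noisy_read e (Suc k) u) A"
proof -
  define M where "M = pair_pmf (noisy_read e k u) (bernoulli_pmf (2 powr (- e (Suc k))))"
  define S where "S = {r. r + (if f \<noteq> bit u k then 2 ^ k else 0) \<in> A}"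
  have "pmf (bernoulli_pmf (2 powr (- e (Suc k)))) f * measure_pmf.prob (noisy_read e k u) S =
        measure_pmf.prob M (S \<times> {f})"
    unfolding M_def by (subst measure_pmf_prob_product) (auto simp: measure_pmf_single)
  also have "\<dots> \<le> measure_pmf.prob M ((\<lambda>(r, f). r + (if f \<noteq> bit u k then 2 ^ k else 0)) -` A)"
    by (intro measure_pmf.finite_measure_mono) (auto simp: S_def)
  also have "\<dots> = measure_pmf.prob (noisy_read e (Suc k) u) A"
    by (simp only: M_def noisy_read_Suc_conv_pair measure_map_pmf)
  finally show ?thesis unfolding S_def .
qed

lemma powr_minus_le_half:
  assumes "1 \<le> x"
  shows "2 powr (- x) \<le> (1 / 2 :: real)"
proof -
  have "2 powr (- x) \<le> 2 powr (- 1 :: real)" using assms by (intro powr_mono) auto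
  then show ?thesis by (simp add: powr_minus)
qed

text \<open>Energy at least 1 makes each of the \<open>d\<close> bits above the lowest
  \<open>m\<close> correct with probability at least \<open>1 / 2\<close>; the lowest
  \<open>m\<close> readings are arbitrary.\<close>

lemma noisy_read_exact_ge:
  assumes "\<And>j. m < j \<Longrightarrow> j \<le> m + d \<Longrightarrow> 1 \<le> e j"
  shows "(1 / 2) ^ d \<le> measure_pmf.prob (noisy_read e (m + d) u) {r. r div 2 ^ m = u div 2 ^ m mod 2 ^ d}"
  using assms
proof (induction d)
  case 0
  have "measure_pmf.prob (noisy_read e m u) {r. r div 2 ^ m = 0} = 1"
    by (subst measure_pmf.prob_eq_1) (auto simp: AE_measure_pmf_iff dest: noisy_read_less)
  then show ?case by simp
next
  case (Suc d)
  define q where "q = 2 powr (- e (Suc (m + d)))"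
  have "q \<le> 1 / 2" unfolding q_def by (rule powr_minus_le_half) (simp add: Suc.prems)
  moreover have "0 \<le> q" by (simp add: q_def)
  ultimately have q: "1 / 2 \<le> pmf (bernoulli_pmf q) False" by simp
  have b: "bit (u div 2 ^ m) d = bit u (m + d)"
    by (simp add: bit_iff_odd power_add div_mult2_eq)
  have "(1 / 2) ^ Suc d \<le> pmf (bernoulli_pmf q) False *
      measure_pmf.prob (noisy_read e (m + d) u) {r. r div 2 ^ m = u div 2 ^ m mod 2 ^ d}"
    unfolding power_Suc using Suc q by (intro mult_mono) auto
  \<comment> \<open>Agreement on \<open>d\<close> bits and an unflipped bit at position
    \<open>m + d\<close> amount to agreement on \<open>Suc d\<close> bits.\<close>
  also have "{r. r div 2 ^ m = u div 2 ^ m mod 2 ^ d} =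
     {r. r + (if False \<noteq> bit u (m + d) then 2 ^ (m + d) else 0) \<in> {r. r div 2 ^ m = u div 2 ^ m mod 2 ^ Suc d}}"
    unfolding mod_2_power_Suc b by (auto simp: power_add)
  also have "pmf (bernoulli_pmf q) False * measure_pmf.prob (noisy_read e (m + d) u) \<dots> \<le>
     measure_pmf.prob (noisy_read e (Suc (m + d)) u) {r. r div 2 ^ m = u div 2 ^ m mod 2 ^ Suc d}"
    unfolding q_def by (rule noisy_read_Suc_ge)
  finally show ?case by simp
qed

text \<open>Flipping only the leading bit turns 101 into 001. The factor \<open>1 / 4\<close>
  accounts for reading the other two bits correctly.\<close>

lemma noisy_read_flip_top_ge:
  assumes e: "\<And>j. m < j \<Longrightarrow> j \<le> m + 3 \<Longrightarrow> 1 \<le> e j" and u: "u div 2 ^ m = 5"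
  shows "2 powr (- e (m + 3)) / 4 \<le> measure_pmf.prob (noisy_read e (m + 3) u) {r. r div 2 ^ m = 1}"
proof -
  define q where "q = 2 powr (- e (Suc (m + 2)))"
  have "q \<le> 1 / 2" unfolding q_def by (rule powr_minus_le_half) (simp add: e)
  moreover have "0 \<le> q" by (simp add: q_def)
  ultimately have q: "pmf (bernoulli_pmf q) True = q" by simp
  have "u div 2 ^ (m + 2) = u div 2 ^ m div 4" unfolding power_add div_mult2_eq by simp
  then have b: "bit u (m + 2)" by (simp add: bit_iff_odd u)
  have "q / 4 = q * (1 / 2) ^ 2" by (simp add: power2_eq_square)
  also have "\<dots> \<le> q * measure_pmf.prob (noisy_read e (m + 2) u) {r. r div 2 ^ m = u div 2 ^ m mod 2 ^ 2}"
    using \<open>0 \<le> q\<close> by (intro mult_left_mono noisy_read_exact_ge e) auto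
  also have "{r. r div 2 ^ m = u div 2 ^ m mod 2 ^ 2} =
     {r. r + (if True \<noteq> bit u (m + 2) then 2 ^ (m + 2) else 0) \<in> {r. r div 2 ^ m = 1}}"
    using b by (auto simp: u)
  also have "q * measure_pmf.prob (noisy_read e (m + 2) u) \<dots> \<le>
     measure_pmf.prob (noisy_read e (Suc (m + 2)) u) {r. r div 2 ^ m = 1}"
    using noisy_read_Suc_ge[of e "m + 2" True u "{r. r div 2 ^ m = 1}"] unfolding q_def[symmetric] q .
  finally show ?thesis by (simp add: q_def numeral_3_eq_3)
qed

lemma less_if_div_less: "r div k < s div k \<Longrightarrow> r < s" for r s k :: nat
  by (metis div_le_mono not_less)

text \<open>The parts above the lowest \<open>m\<close> bits already decide the order, and the two
  readings are independent.\<close>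

lemma inexact_less_True_ge:
  assumes "i < j"
  shows "measure_pmf.prob (noisy_read e n (C ! x)) {r. r div 2 ^ m = i} *
         measure_pmf.prob (noisy_read e n (C ! p)) {r. r div 2 ^ m = j} \<le> pmf (inexact_less e n C x p) True"
proof -
  have "r < s" if "r div 2 ^ m = i" "s div 2 ^ m = j" for r s :: nat
    using less_if_div_less[of r "2 ^ m" s] that assms by simp
  then have "{r. r div 2 ^ m = i} \<times> {r. r div 2 ^ m = j} \<subseteq> (\<lambda>(r, s). r < s) -` {True}"
    by auto
  then show ?thesis
    by (subst measure_pmf_prob_product[symmetric])
       (auto simp: inexact_less_conv_pair pmf_map intro!: measure_pmf.finite_measure_mono)
qed

lemma inexact_less_False_ge:
  assumes "j < i"
  shows "measure_pmf.prob (noisy_read e n (C ! x)) {r. r div 2 ^ m = i} *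
         measure_pmf.prob (noisy_read e n (C ! p)) {r. r div 2 ^ m = j} \<le> pmf (inexact_less e n C x p) False"
proof -
  have "\<not> r < s" if "r div 2 ^ m = i" "s div 2 ^ m = j" for r s :: nat
    using less_if_div_less[of s "2 ^ m" r] that assms by simp
  then have "{r. r div 2 ^ m = i} \<times> {r. r div 2 ^ m = j} \<subseteq> (\<lambda>(r, s). r < s) -` {False}"
    by auto
  then show ?thesis
    by (subst measure_pmf_prob_product[symmetric])
       (auto simp: inexact_less_conv_pair pmf_map intro!: measure_pmf.finite_measure_mono)
qed

text \<open>It suffices that \<open>b\<close> reads as 001 and the pivot as 010 in one comparison,
  and \<open>a\<close> as 011 and the pivot as 010 in the other. The four readings contribute
  \<open>1 / 4\<close> (times the flip probability) and three factors \<open>1 / 8\<close>, hence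
  \<open>2048 = 4 * 8 ^ 3\<close>.\<close>

lemma inexact_separation_ge:
  assumes e: "\<And>j. m < j \<Longrightarrow> j \<le> m + 3 \<Longrightarrow> 1 \<le> e j"
    and C: "C ! a div 2 ^ m = 3" "C ! b div 2 ^ m = 5" "C ! p div 2 ^ m = 2"
  shows "2 powr (- e (m + 3)) / 2048 \<le>
    pmf (inexact_less e (m + 3) C b p) True * pmf (inexact_less e (m + 3) C a p) False"
proof -
  define q where "q = 2 powr (- e (m + 3))"
  have q: "0 \<le> q" by (simp add: q_def)
  have pa: "1 / 8 \<le> measure_pmf.prob (noisy_read e (m + 3) (C ! a)) {r. r div 2 ^ m = 3}"
    using noisy_read_exact_ge[of m 3 e "C ! a"] e by (simp add: C power3_eq_cube)
  have pp: "1 / 8 \<le> measure_pmf.prob (noisy_read e (m + 3) (C ! p)) {r. r div 2 ^ m = 2}"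
    using noisy_read_exact_ge[of m 3 e "C ! p"] e by (simp add: C power3_eq_cube)
  have pb: "q / 4 \<le> measure_pmf.prob (noisy_read e (m + 3) (C ! b)) {r. r div 2 ^ m = 1}"
    unfolding q_def using e C by (intro noisy_read_flip_top_ge) auto
  have "q / 4 * (1 / 8) \<le> pmf (inexact_less e (m + 3) C b p) True"
    by (rule order.trans[OF mult_mono[OF pb pp] inexact_less_True_ge]) (use q in auto)
  moreover have "1 / 8 * (1 / 8) \<le> pmf (inexact_less e (m + 3) C a p) False"
    by (rule order.trans[OF mult_mono[OF pa pp] inexact_less_False_ge]) auto
  ultimately have "(q / 4 * (1 / 8)) * (1 / 8 * (1 / 8)) \<le>
      pmf (inexact_less e (m + 3) C b p) True * pmf (inexact_less e (m + 3) C a p) False"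
    using q by (intro mult_mono) auto
  then show ?thesis by (simp add: q_def)
qed

section \<open>Counting inputs with prescribed leading bits\<close>

lemma card_lists_nth:
  "card {C. length C = N \<and> (\<forall>i<N. C ! i \<in> A i)} = (\<Prod>i<N. card (A i))"
proof -
  have "{C. length C = N \<and> (\<forall>i<N. C ! i \<in> A i)} = (\<lambda>f. map f [0..<N]) ` (\<Pi>\<^sub>E i\<in>{..<N}. A i)"
  proof (intro equalityI subsetI)
    fix C assume "C \<in> {C. length C = N \<and> (\<forall>i<N. C ! i \<in> A i)}"
    then show "C \<in> (\<lambda>f. map f [0..<N]) ` (\<Pi>\<^sub>E i\<in>{..<N}. A i)"
      by (intro image_eqI[of _ _ "restrict ((!) C) {..<N}"]) (auto intro!: nth_equalityI)
  next
    fix C assume "C \<in> (\<lambda>f. map f [0..<N]) ` (\<Pi>\<^sub>E i\<in>{..<N}. A i)"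
    then obtain f where "f \<in> (\<Pi>\<^sub>E i\<in>{..<N}. A i)" "C = map f [0..<N]" by blast
    then show "C \<in> {C. length C = N \<and> (\<forall>i<N. C ! i \<in> A i)}" by (simp add: PiE_mem)
  qed
  moreover have "inj_on (\<lambda>f. map f [0..<N]) (\<Pi>\<^sub>E i\<in>{..<N}. A i)"
  proof (rule inj_onI)
    fix f g assume fg: "f \<in> (\<Pi>\<^sub>E i\<in>{..<N}. A i)" "g \<in> (\<Pi>\<^sub>E i\<in>{..<N}. A i)"
      and "map f [0..<N] = map g [0..<N]"
    then have "f i = g i" if "i \<in> {..<N}" for i using that by simp
    with fg show "f = g" by (rule PiE_ext)
  qed
  ultimately show ?thesis by (simp add: card_image card_PiE)
qed

text \<open>A constrained position keeps \<open>2 ^ m\<close> of its \<open>2 ^ (m + 3)\<close>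
  values, so each of them costs a factor 8. The product form avoids division of natural
  numbers.\<close>

lemma card_lists_pattern:
  fixes t :: "nat \<Rightarrow> nat"
  assumes T: "T \<subseteq> {..<N}" and t: "\<And>i. i \<in> T \<Longrightarrow> t i < 8"
  shows "8 ^ card T * card {C. length C = N \<and> set C \<subseteq> {0..<2 ^ (m + 3)} \<and> (\<forall>i\<in>T. C ! i div 2 ^ m = t i)} =
         card {C :: nat list. length C = N \<and> set C \<subseteq> {0..<2 ^ (m + 3)}}"
proof -
  define A where "A i = (if i \<in> T then {t i * 2 ^ m..<Suc (t i) * 2 ^ m} else {0..<2 ^ (m + 3)})" for i
  have iff: "c div 2 ^ m = k \<longleftrightarrow> c \<in> {k * 2 ^ m..<Suc k * 2 ^ m}" for c k :: nat
    by (auto simp: mult.commute intro!: div_nat_eqI dividend_less_times_div)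
  have sub: "{t i * 2 ^ m..<Suc (t i) * 2 ^ m} \<subseteq> {0..<2 ^ (m + 3)}" if "i \<in> T" for i
  proof -
    have "Suc (t i) * 2 ^ m \<le> 8 * 2 ^ m" using t[OF that] by (intro mult_le_mono) auto
    then show ?thesis by (auto simp: power_add)
  qed
  have "{C. length C = N \<and> set C \<subseteq> {0..<2 ^ (m + 3)} \<and> (\<forall>i\<in>T. C ! i div 2 ^ m = t i)} =
      {C. length C = N \<and> (\<forall>i<N. C ! i \<in> A i)}"
  proof (rule Collect_cong, rule conj_cong[OF refl])
    fix C :: "nat list" assume len: "length C = N"
    show "(set C \<subseteq> {0..<2 ^ (m + 3)} \<and> (\<forall>i\<in>T. C ! i div 2 ^ m = t i)) = (\<forall>i<N. C ! i \<in> A i)"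
    proof -
      have "set C \<subseteq> {0..<2 ^ (m + 3)} \<longleftrightarrow> (\<forall>i<N. C ! i \<in> {0..<2 ^ (m + 3)})"
        unfolding len[symmetric] by (auto simp: set_conv_nth)
      moreover have "C ! i \<in> A i \<longleftrightarrow> C ! i \<in> {0..<2 ^ (m + 3)} \<and> (i \<in> T \<longrightarrow> C ! i div 2 ^ m = t i)" for i
        unfolding iff using sub[of i] by (cases "i \<in> T") (simp_all only: A_def if_True if_False, blast+)
      ultimately show ?thesis using T by blast
    qed
  qed
  then have "8 ^ card T * card {C. length C = N \<and> set C \<subseteq> {0..<2 ^ (m + 3)} \<and> (\<forall>i\<in>T. C ! i div 2 ^ m = t i)}
     = 8 ^ card T * (\<Prod>i<N. card (A i))"
    by (simp add: card_lists_nth)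
  also have "\<dots> = (\<Prod>i<N. if i \<in> T then 8 else 1) * (\<Prod>i<N. card (A i))"
    using T by (simp add: prod.If_cases Int_absorb1)
  also have "\<dots> = (\<Prod>i<N. 2 ^ (m + 3))"
    unfolding prod.distrib[symmetric] by (rule prod.cong) (auto simp: A_def power_add)
  also have "\<dots> = card {C :: nat list. length C = N \<and> set C \<subseteq> {0..<2 ^ (m + 3)}}"
    using card_lists_length_eq[of "{0..<2 ^ (m + 3)} :: nat set" N] by (simp add: conj_commute)
  finally show ?thesis .
qed

section \<open>Contribution of one pair for a fixed input\<close>

text \<open>The quicksort bound is applied to indices valued by their entries, with
  \<open>K = 4\<close> from \<open>misread_aware\<close>. Equal entries, which a random input may
  contain, have weight zero.\<close>

lemma pair_wkt_aware_le:
  assumes C: "set C \<subseteq> {0..<2 ^ n}" and ab: "a < length C" "b < length C"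
  shows "\<bar>real (C ! a) - real (C ! b)\<bar> *
    measure_pmf.prob (quicksort_pmf (inexact_less (e_aware n) n C) [0..<length C]) {out. misordered C a b out}
    \<le> 8 * real (length C)"
proof -
  define M where "M = quicksort_pmf (inexact_less (e_aware n) n C) [0..<length C]"
  have bound: "C ! i < 2 ^ n" if "i < length C" for i
    using C nth_mem[OF that] by auto
  have main: "(real (C ! y) - real (C ! x)) * measure_pmf.prob M {out. precedes y x out} \<le> 2 * 4 * real (length C)"
    if xy: "x < length C" "y < length C" "C ! x < C ! y" for x y
  proof -
    have "(real (C ! y) - real (C ! x)) * measure_pmf.prob M {out. precedes y x out}
        \<le> 2 * 4 * real (length [0..<length C])"
      unfolding M_def
    proof (rule quicksort_precedes_weighted[where val = "\<lambda>i. real (C ! i)" and A = "{..<length C}"])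
      fix z p assume z: "z \<in> {..<length C}" and p: "p \<in> {..<length C}"
      show "(real (C ! p) - real (C ! z)) * pmf (inexact_less (e_aware n) n C z p) False \<le> 4"
        if "real (C ! z) < real (C ! p)"
        unfolding inexact_less_False using that bound p by (intro misread_aware) auto
      show "(real (C ! z) - real (C ! p)) * pmf (inexact_less (e_aware n) n C z p) True \<le> 4"
        if "real (C ! p) < real (C ! z)"
      proof -
        have "(real (C ! z) - real (C ! p)) * pmf (inexact_less (e_aware n) n C z p) True \<le>
              (real (C ! z) - real (C ! p)) * misread (e_aware n) n (C ! p) (C ! z)"
          using that by (intro mult_left_mono inexact_less_True) auto
        also have "\<dots> \<le> 4" using that bound z by (intro misread_aware) auto
        finally show ?thesis .
      qed
    qed (use xy in auto)
    then show ?thesis by simp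
  qed
  consider "C ! a < C ! b" | "C ! b < C ! a" | "C ! a = C ! b" by linarith
  then show ?thesis
  proof cases
    case 1
    then have "{out. misordered C a b out} = {out. precedes b a out}"
      by (auto simp: misordered_conv_precedes)
    then show ?thesis using main[OF ab 1] 1 by (simp add: M_def)
  next
    case 2
    then have "{out. misordered C a b out} = {out. precedes a b out}"
      by (auto simp: misordered_conv_precedes)
    then show ?thesis using main[OF ab(2,1) 2] 2 by (simp add: M_def)
  qed simp
qed

text \<open>The bound stays a sum of indicator terms over pivots, so that averaging over inputs
  reduces to counting patterns. Leading parts 3 and 5 force a gap of at least
  \<open>2 ^ m\<close>.\<close>

lemma pair_wkt_ge:
  assumes e: "\<And>j. m < j \<Longrightarrow> j \<le> m + 3 \<Longrightarrow> 1 \<le> e j"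
    and ab: "a < length C" "b < length C" "a \<noteq> b"
  shows "(\<Sum>p\<in>{..<length C} - {a, b}.
      if C ! a div 2 ^ m = 3 \<and> C ! b div 2 ^ m = 5 \<and> C ! p div 2 ^ m = 2
      then 2 ^ m * 2 powr (- e (m + 3)) / (2048 * real (length C)) else 0)
    \<le> \<bar>real (C ! a) - real (C ! b)\<bar> *
      measure_pmf.prob (quicksort_pmf (inexact_less e (m + 3) C) [0..<length C]) {out. misordered C a b out}"
    (is "?S \<le> ?R")
proof (cases "C ! a div 2 ^ m = 3 \<and> C ! b div 2 ^ m = 5")
  case False
  then have "?S = 0" by (intro sum.neutral) auto
  then show ?thesis by simp
next
  case True
  define M where "M = quicksort_pmf (inexact_less e (m + 3) C) [0..<length C]"
  define f where "f p = pmf (inexact_less e (m + 3) C b p) True * pmf (inexact_less e (m + 3) C a p) False" for p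
  define q where "q = 2 powr (- e (m + 3))"
  have q: "0 \<le> q" by (simp add: q_def)
  have "C ! a < 4 * 2 ^ m" using dividend_less_times_div[of "2 ^ m" "C ! a"] True by simp
  moreover have "2 ^ m * (C ! b div 2 ^ m) \<le> C ! b" by (rule times_div_less_eq_dividend)
  then have "5 * 2 ^ m \<le> C ! b" using True by simp
  ultimately have less: "C ! a + 2 ^ m \<le> C ! b" by linarith
  then have "real (C ! a + 2 ^ m) \<le> real (C ! b)" by (simp only: of_nat_le_iff)
  then have gap: "2 ^ m \<le> \<bar>real (C ! a) - real (C ! b)\<bar>" by simp
  have "C ! a < C ! b" using less by (rule less_le_trans[rotated]) simp
  then have prec: "{out. misordered C a b out} = {out. precedes b a out}"
    by (auto simp: misordered_conv_precedes)
  have "?S \<le> (\<Sum>p\<in>{..<length C} - {a, b}. 2 ^ m * (f p / real (length C)))"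
  proof (rule sum_mono)
    fix p
    show "(if C ! a div 2 ^ m = 3 \<and> C ! b div 2 ^ m = 5 \<and> C ! p div 2 ^ m = 2
      then 2 ^ m * 2 powr (- e (m + 3)) / (2048 * real (length C)) else 0) \<le> 2 ^ m * (f p / real (length C))"
    proof (cases "C ! p div 2 ^ m = 2")
      case p: True
      have "q / 2048 \<le> f p"
        unfolding f_def q_def using True p e by (intro inexact_separation_ge) auto
      then have "2 ^ m * (q / 2048 / real (length C)) \<le> 2 ^ m * (f p / real (length C))"
        by (intro mult_left_mono divide_right_mono) auto
      then show ?thesis using True p by (simp add: q_def)
    qed (simp add: f_def)
  qed
  also have "\<dots> = 2 ^ m * ((\<Sum>p\<in>set [0..<length C] - {a, b}. f p) / real (length [0..<length C]))"
    by (simp add: sum_distrib_left sum_divide_distrib lessThan_atLeast0)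
  also have "\<dots> \<le> 2 ^ m * measure_pmf.prob M {out. precedes b a out}"
    unfolding M_def f_def using ab by (intro mult_left_mono quicksort_precedes_ge) auto
  also have "\<dots> \<le> \<bar>real (C ! a) - real (C ! b)\<bar> * measure_pmf.prob M {out. precedes b a out}"
    using gap by (intro mult_right_mono) auto
  finally show ?thesis unfolding M_def prec .
qed

section \<open>Averaging over all inputs\<close>

definition inputs :: "nat \<Rightarrow> nat \<Rightarrow> nat list set" where
  "inputs N n = {C. length C = N \<and> set C \<subseteq> {0..<2 ^ n}}"

lemma finite_inputs: "finite (inputs N n)"
  using finite_lists_length_eq[of "{0..<2 ^ n} :: nat set" N] by (simp add: inputs_def conj_commute)

lemma inputs_nonempty: "inputs N n \<noteq> {}"
proof -
  have "replicate N 0 \<in> inputs N n" by (auto simp: inputs_def)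
  then show ?thesis by blast
qed

lemma expected_wkt_conv_sum:
  "expected_wkt N n e = (\<Sum>C\<in>inputs N n. wkt n C e) / real (card (inputs N n))"
  unfolding expected_wkt_def random_input_def inputs_def[symmetric]
  by (rule integral_pmf_of_set[OF inputs_nonempty finite_inputs])

text \<open>The bound holds for every single input. It is kept as a sum over pairs so that the
  number of pairs can cancel later.\<close>

lemma expected_wkt_aware_le:
  "expected_wkt N n (e_aware n) \<le> (\<Sum>a<N. \<Sum>b\<in>{a<..<N}. 8 * real N)"
proof -
  have "wkt n C (e_aware n) \<le> (\<Sum>a<N. \<Sum>b\<in>{a<..<N}. 8 * real N)" if "C \<in> inputs N n" for C
  proof -
    have C: "set C \<subseteq> {0..<2 ^ n}" and N: "N = length C" using that by (auto simp: inputs_def)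
    show ?thesis unfolding wkt_def N by (intro sum_mono pair_wkt_aware_le C) auto
  qed
  then have "(\<Sum>C\<in>inputs N n. wkt n C (e_aware n)) \<le>
      real (card (inputs N n)) * (\<Sum>a<N. \<Sum>b\<in>{a<..<N}. 8 * real N)"
    by (rule sum_bounded_above)
  moreover have "0 < card (inputs N n)"
    using finite_inputs inputs_nonempty by (simp add: card_gt_0_iff)
  ultimately show ?thesis
    unfolding expected_wkt_conv_sum by (subst pos_divide_le_eq) (simp_all add: mult.commute)
qed

lemma card_inputs_pattern:
  assumes "a < N" "b < N" "p < N" "distinct [a, b, p]"
  shows "real (card {C \<in> inputs N (m + 3). C ! a div 2 ^ m = 3 \<and> C ! b div 2 ^ m = 5 \<and> C ! p div 2 ^ m = 2})
    = real (card (inputs N (m + 3))) / 512"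
proof -
  \<comment> \<open>The default 2 is the pattern required at \<open>p\<close>.\<close>
  define t :: "nat \<Rightarrow> nat" where "t i = (if i = a then 3 else if i = b then 5 else 2)" for i
  have "{C \<in> inputs N (m + 3). C ! a div 2 ^ m = 3 \<and> C ! b div 2 ^ m = 5 \<and> C ! p div 2 ^ m = 2} =
    {C. length C = N \<and> set C \<subseteq> {0..<2 ^ (m + 3)} \<and> (\<forall>i\<in>{a, b, p}. C ! i div 2 ^ m = t i)}" (is "?L = ?R")
    using assms by (auto simp: inputs_def t_def)
  moreover have "8 ^ card {a, b, p} * card ?R = card (inputs N (m + 3))"
    unfolding inputs_def using assms by (intro card_lists_pattern) (auto simp: t_def)
  moreover have "card {a, b, p} = 3" using assms by simp
  ultimately have "512 * card ?L = card (inputs N (m + 3))" by simp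
  then show ?thesis by (simp flip: of_nat_mult)
qed

text \<open>Exchanging the sums puts the inputs innermost; for fixed distinct positions
  \<open>a\<close>, \<open>b\<close>, \<open>p\<close>, one input in 512 shows the pattern.\<close>

lemma expected_wkt_ge:
  assumes e: "\<And>j. m < j \<Longrightarrow> j \<le> m + 3 \<Longrightarrow> 1 \<le> e j" and N: "3 \<le> N"
  shows "(\<Sum>a<N. \<Sum>b\<in>{a<..<N}. 2 ^ m * 2 powr (- e (m + 3)) / 2 ^ 22) \<le> expected_wkt N (m + 3) e"
proof -
  define S where "S = inputs N (m + 3)"
  define L where "L = 2 ^ m * 2 powr (- e (m + 3)) / (2048 * real N)"
  define P where "P a b p C \<longleftrightarrow> C ! a div 2 ^ m = 3 \<and> C ! b div 2 ^ m = 5 \<and> C ! p div 2 ^ m = 2"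
    for a b p and C :: "nat list"
  have L: "0 \<le> L" by (simp add: L_def)
  have S: "finite S" "0 < card S"
    using finite_inputs inputs_nonempty by (simp_all add: S_def card_gt_0_iff)
  have "2 ^ m * 2 powr (- e (m + 3)) / 2 ^ 22 * real (card S) \<le>
      (\<Sum>C\<in>S. \<Sum>p\<in>{..<N} - {a, b}. if P a b p C then L else 0)"
    if ab: "a < N" "b \<in> {a<..<N}" for a b
  proof -
    have "(\<Sum>C\<in>S. \<Sum>p\<in>{..<N} - {a, b}. if P a b p C then L else 0) =
        (\<Sum>p\<in>{..<N} - {a, b}. \<Sum>C\<in>S. if P a b p C then L else 0)"
      by (rule sum.swap)
    also have "\<dots> = (\<Sum>p\<in>{..<N} - {a, b}. real (card S) / 512 * L)"
    proof (rule sum.cong[OF refl])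
      fix p assume p: "p \<in> {..<N} - {a, b}"
      have "(\<Sum>C\<in>S. if P a b p C then L else 0) = real (card {C \<in> S. P a b p C}) * L"
        using S by (simp flip: sum.inter_filter)
      also have "real (card {C \<in> S. P a b p C}) = real (card S) / 512"
        unfolding S_def P_def using ab p by (intro card_inputs_pattern) auto
      finally show "(\<Sum>C\<in>S. if P a b p C then L else 0) = real (card S) / 512 * L" .
    qed
    also have "\<dots> = real (N - 2) * (real (card S) / 512 * L)"
      using ab by (subst sum_constant, subst card_Diff_subset) auto
    \<comment> \<open>\<open>N - 2 \<ge> N / 4\<close> holds from \<open>N = 3\<close> on. The
      factor \<open>N\<close> then cancels the \<open>1 / N\<close> in \<open>L\<close>, and
      \<open>4 * 512 * 2048 = 2 ^ 22\<close>.\<close>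
    also have "\<dots> \<ge> real N / 4 * (real (card S) / 512 * L)"
      using N L by (intro mult_right_mono) auto
    moreover have "real N / 4 * (real (card S) / 512 * L) = 2 ^ m * 2 powr (- e (m + 3)) / 2 ^ 22 * real (card S)"
      using N by (simp add: L_def field_simps)
    ultimately show ?thesis by linarith
  qed
  then have "(\<Sum>a<N. \<Sum>b\<in>{a<..<N}. 2 ^ m * 2 powr (- e (m + 3)) / 2 ^ 22 * real (card S)) \<le>
      (\<Sum>a<N. \<Sum>b\<in>{a<..<N}. \<Sum>C\<in>S. \<Sum>p\<in>{..<N} - {a, b}. if P a b p C then L else 0)"
    by (intro sum_mono) auto
  also have "\<dots> = (\<Sum>a<N. \<Sum>C\<in>S. \<Sum>b\<in>{a<..<N}. \<Sum>p\<in>{..<N} - {a, b}. if P a b p C then L else 0)"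
    by (intro sum.cong refl sum.swap)
  also have "\<dots> = (\<Sum>C\<in>S. \<Sum>a<N. \<Sum>b\<in>{a<..<N}. \<Sum>p\<in>{..<N} - {a, b}. if P a b p C then L else 0)"
    by (rule sum.swap)
  also have "\<dots> \<le> (\<Sum>C\<in>S. wkt (m + 3) C e)"
  proof (rule sum_mono)
    fix C assume "C \<in> S"
    then have N_eq: "N = length C" by (simp add: S_def inputs_def)
    show "(\<Sum>a<N. \<Sum>b\<in>{a<..<N}. \<Sum>p\<in>{..<N} - {a, b}. if P a b p C then L else 0) \<le> wkt (m + 3) C e"
      unfolding wkt_def P_def L_def N_eq using e by (intro sum_mono pair_wkt_ge) auto
  qed
  finally show ?thesis
    using S(2) unfolding expected_wkt_conv_sum S_def[symmetric]
    by (subst pos_le_divide_eq) (simp_all add: sum_distrib_right mult.assoc)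
qed

section \<open>The quotient of the two expectations\<close>

theorem theorem6:
  "\<exists>c>0. \<exists>N0 n0. \<forall>N\<ge>N0. \<forall>n\<ge>n0.
     alpha_star N n \<ge> c * (2 powr (real n / 2) / (real N * ln (real N)))"
proof (intro exI conjI allI impI)
  \<comment> \<open>\<open>2 ^ 29\<close> collects \<open>2 ^ 22\<close> from the numerator, 8 from
    the denominator and 16 from rounding the exponent.\<close>
  show "(0 :: real) < 1 / 2 ^ 29" by simp
next
  \<comment> \<open>This sets both thresholds to 3: a pair needs a third item as pivot,
    \<open>ln N \<ge> 1\<close> has to hold, and three top bits are prescribed.\<close>
  fix N n :: nat assume N: "3 \<le> N" and n: "3 \<le> n"
  define m where "m = n - 3"
  have nm: "n = m + 3" using n by (simp add: m_def)
  define P where "P = (\<Sum>a<N. real (card {a<..<N}))"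
  have pairs: "(\<Sum>a<N. \<Sum>b\<in>{a<..<N}. c) = P * c" for c :: real
    by (simp add: P_def sum_distrib_right)
  have "real (card {0<..<N}) \<le> P"
    unfolding P_def using N by (intro member_le_sum) auto
  then have P: "0 < P" using N by simp
  have "P * (2 ^ m * 2 powr (- e_aware n (m + 3)) / 2 ^ 22) \<le> expected_wkt N n (e_aware n)"
    unfolding pairs[symmetric] unfolding nm by (rule expected_wkt_ge) (use N in \<open>auto simp: e_aware_def\<close>)
  moreover have "0 < P * (2 ^ m * 2 powr (- e_aware n (m + 3)) / 2 ^ 22)" using P by simp
  ultimately have pos: "0 < expected_wkt N n (e_aware n)" by linarith
  have up: "expected_wkt N n (e_aware n) \<le> P * (8 * real N)"
    using expected_wkt_aware_le[of N n] unfolding pairs .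
  have lo: "P * (2 ^ m * 2 powr (- e_oblivious n (m + 3)) / 2 ^ 22) \<le> expected_wkt N n (e_oblivious n)"
    unfolding pairs[symmetric] unfolding nm by (rule expected_wkt_ge) (use N in \<open>auto simp: e_oblivious_def\<close>)
  \<comment> \<open>The exponent \<open>m - (n + 1) / 2\<close> equals \<open>n / 2 - 7 / 2\<close>,
    which is rounded down to \<open>n / 2 - 4\<close>.\<close>
  have "2 powr (real n / 2) / 16 = 2 powr (real n / 2 + - 4)"
    unfolding powr_add by (simp add: powr_minus_divide)
  also have "\<dots> \<le> 2 powr (real m + - ((real n + 1) / 2))"
    by (intro powr_mono) (auto simp: nm field_simps)
  also have "\<dots> = 2 ^ m * 2 powr (- e_oblivious n (m + 3))"
    unfolding powr_add by (simp add: e_oblivious_def powr_realpow)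
  finally have ex: "2 powr (real n / 2) / 16 \<le> 2 ^ m * 2 powr (- e_oblivious n (m + 3))" .
  have "exp 1 \<le> real N" using exp_le N by linarith
  then have ln: "1 \<le> ln (real N)" using N by (subst ln_ge_iff) auto
  \<comment> \<open>Since \<open>ln N \<ge> 1\<close>, replacing the logarithm by 1 only increases
    the bound to be proved.\<close>
  have "1 / 2 ^ 29 * (2 powr (real n / 2) / (real N * ln (real N))) \<le>
      1 / 2 ^ 29 * (2 powr (real n / 2) / (real N * 1))"
    using ln N by (intro mult_left_mono divide_left_mono) auto
  also have "\<dots> = P * (2 powr (real n / 2) / 16 / 2 ^ 22) / (P * (8 * real N))"
    using P N by (simp add: field_simps)
  also have "\<dots> \<le> expected_wkt N n (e_oblivious n) / expected_wkt N n (e_aware n)"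
  proof (rule frac_le)
    have "P * (2 powr (real n / 2) / 16 / 2 ^ 22) \<le> P * (2 ^ m * 2 powr (- e_oblivious n (m + 3)) / 2 ^ 22)"
      using ex P by (intro mult_left_mono divide_right_mono) auto
    then show "P * (2 powr (real n / 2) / 16 / 2 ^ 22) \<le> expected_wkt N n (e_oblivious n)"
      using lo by linarith
    then show "0 \<le> expected_wkt N n (e_oblivious n)"
      by (rule order.trans[rotated]) (use P in simp)
  qed (rule pos, rule up)
  finally show "1 / 2 ^ 29 * (2 powr (real n / 2) / (real N * ln (real N))) \<le> alpha_star N n"
    unfolding alpha_star_def .
qed

end
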